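(* Assume that $f$ is convex with $S(P)=\{a\}$, that $h$ is a Bregman function with zone $C$, and that there exist a neighborhood $U_a$ of $a$ and constants $\alpha>0$, $\beta\ge1$ such that $$f(x)-f(a)\ge\alpha D_h(a,x)^\beta\quad\text{for all }x\in U_a\cap C.$$ Let $x:[0,+\infty)\to\mathcal{F}$ be the solution of $(H\text{-}SD)$: $\dot x(t)+\nabla_Hf_{|\mathcal{F}}(x(t))=0$, $x(0)=x^0\in\mathcal{F}$. Then: (1) if $\beta=1$, there exists $K>0$ such that $D_h(a,x(t))\le Ke^{-\alpha t}$ for all $t>0$; (2) if $\beta>1$, there exists $K'>0$ such that $D_h(a,x(t))\le K'/t^{\frac1{\beta-1}}$ for all $t>0$.
   Context: Let $m<n$ be positive integers, $A\in\mathbb{R}^{m\times n}$ of full rank, $b\in\operatorname{Im}A$, $\mathcal{A}=\{x\in\mathbb{R}^n: Ax=b\}$, $\mathcal{A}_0=\ker A$. Let $C\subset\mathbb{R}^n$ be nonempty, open and convex, with $\mathcal{F}=C\cap\mathcal{A}\neq\emptyset$. The function $f\in\mathcal{C}^1(\mathbb{R}^n)$ has locally Lipschitz continuous gradient $\nabla f$ on $\mathbb{R}^n$. $S(P)$ is the set of optimal solutions of $(P)$: $\inf\{f(x)\mid x\in\overline{C},\ Ax=b\}$. $\Gamma_0(\mathbb{R}^n)$ is the set of lower semicontinuous proper convex functions $\mathbb{R}^n\to\mathbb{R}\cup\{+\infty\}$. A function $h\in\Gamma_0(\mathbb{R}^n)$ is essentially smooth if it is differentiable on $\operatorname{int}\operatorname{dom}h$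 and $|\nabla h(x^j)|\to+\infty$ for every sequence $(x^j)\subset\operatorname{int}\operatorname{dom}h$ converging to a boundary point of $\operatorname{dom}h$; it is of Legendre type if moreover it is strictly convex on $\operatorname{int}\operatorname{dom}h$. The function $h\in\Gamma_0(\mathbb{R}^n)$ is assumed to satisfy: (i) $h$ is of Legendre type with $\operatorname{int}\operatorname{dom}h=C$; (ii) $h_{|C}\in\mathcal{C}^2(C;\mathbb{R})$ and $\nabla^2h(x)$ is symmetric positive definite for all $x\in C$; (iii) $x\mapsto\nabla^2h(x)$ is locally Lipschitz continuous on $C$. Set $H=\nabla^2h$ on $C$, and $D_h(x,y)=h(x)-h(y)-\langle\nabla h(y),x-y\rangle$ for $x\in\operatorname{dom}h$, $y\in C$. A function $h\in\Gamma_0(\mathbb{R}^n)$ is a Bregman function with zone $C$ if: (i) $\operatorname{dom}h=\overline{C}$, $h$ is continuous and strictly convex on $\overline{C}$ and $h_{|C}\in\mathcal{C}^1(C;\mathbb{R})$; (ii) for all $a\in\overline{C}$ and $\gamma\in\mathbb{R}$, $\{y\in C\mid D_h(a,y)\le\gamma\}$ is bounded; (iii) for all $y\in\overline{C}$ and all sequences $y^j\to y$ with $y^j\in C$, $D_h(y,y^j)\to0$. On the submanifold $\mathcal{F}$, with tangent space $\mathcal{A}_0$, consider the Riemannian metric $(u,v)^H_x=\langle H(x)u,v\rangle$; the gradient of $f_{|\mathcal{F}}$ is $\nabla_Hf_{|\mathcal{F}}(x)=H(x)^{-1}[I-A^T(AH(x)^{-1}A^T)^{-1}AH(x)^{-1}]\nabla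 f(x)$. *)

theory Defs
  imports "HOL-Analysis.Analysis"
begin

definition gradient :: "('a::real_inner \<Rightarrow> real) \<Rightarrow> 'a \<Rightarrow> 'a" where
  "gradient g x = (THE D. GDERIV g x :> D)"

definition hessian :: "(real^'n \<Rightarrow> real) \<Rightarrow> real^'n \<Rightarrow> real^'n^'n" where
  "hessian g x = jacobian (gradient g) (at x)"

text \<open>The next two notions are only meant for open sets \<open>S\<close>: derivatives are taken in the
  whole space.\<close>

definition C1_on :: "(real^'n) set \<Rightarrow> (real^'n \<Rightarrow> real) \<Rightarrow> bool" where
  "C1_on S g \<longleftrightarrow> (\<forall>x\<in>S. g differentiable (at x)) \<and> continuous_on S (gradient g)"

definition C2_on :: "(real^'n) set \<Rightarrow> (real^'n \<Rightarrow> real) \<Rightarrow> bool" where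
  "C2_on S g \<longleftrightarrow> C1_on S g \<and> (\<forall>x\<in>S. gradient g differentiable (at x))
     \<and> continuous_on S (hessian g)"

definition locally_lipschitz_on :: "'a::metric_space set \<Rightarrow> ('a \<Rightarrow> 'b::metric_space) \<Rightarrow> bool" where
  "locally_lipschitz_on S g \<longleftrightarrow> (\<forall>x\<in>S. \<exists>u>0. \<exists>L. L-lipschitz_on (cball x u \<inter> S) g)"

definition strictly_convex_on :: "'a::real_vector set \<Rightarrow> ('a \<Rightarrow> real) \<Rightarrow> bool" where
  "strictly_convex_on S g \<longleftrightarrow> convex S \<and>
     (\<forall>x\<in>S. \<forall>y\<in>S. \<forall>u>0. \<forall>v>0. u + v = 1 \<and> x \<noteq> y \<longrightarrow>
        g (u *\<^sub>R x + v *\<^sub>R y) < u * g x + v * g y)"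

definition sym_pos_def :: "real^'n^'n \<Rightarrow> bool" where
  "sym_pos_def M \<longleftrightarrow> transpose M = M \<and> (\<forall>v. v \<noteq> 0 \<longrightarrow> (M *v v) \<bullet> v > 0)"

text \<open>Extended-valued convex functions. On its effective domain, such a function is handled
  through its real-valued version \<open>finite_part h\<close>; the values of the latter outside
  the domain carry no meaning. In \<^term>\<open>Gamma0\<close>, note that \<open>0 * \<infinity> = 0\<close> in
  \<^typ>\<open>ereal\<close>, so the convexity inequality is harmless for the weights 0 and 1.\<close>

definition edom :: "('a \<Rightarrow> ereal) \<Rightarrow> 'a set" where
  "edom h = {x. h x < \<infinity>}"

definition finite_part :: "('a \<Rightarrow> ereal) \<Rightarrow> 'a \<Rightarrow> real" where
  "finite_part h x = real_of_ereal (h x)"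

definition Gamma0 :: "('a::real_normed_vector \<Rightarrow> ereal) set" where
  "Gamma0 = {h.
     (\<forall>x. h x \<le> Liminf (at x) h) \<and>
     (\<forall>x. h x \<noteq> -\<infinity>) \<and> edom h \<noteq> {} \<and>
     (\<forall>x y. \<forall>u\<ge>0. \<forall>v\<ge>0. u + v = 1 \<longrightarrow>
        h (u *\<^sub>R x + v *\<^sub>R y) \<le> ereal u * h x + ereal v * h y)}"

definition essentially_smooth :: "(real^'n \<Rightarrow> ereal) \<Rightarrow> bool" where
  "essentially_smooth h \<longleftrightarrow> h \<in> Gamma0 \<and>
     (\<forall>x\<in>interior (edom h). finite_part h differentiable (at x)) \<and>
     (\<forall>X x. (\<forall>j. X j \<in> interior (edom h)) \<and> x \<in> frontier (edom h) \<and> X \<longlonglongrightarrow> x \<longrightarrow>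
        filterlim (\<lambda>j. norm (gradient (finite_part h) (X j))) at_top sequentially)"

definition legendre_type :: "(real^'n \<Rightarrow> ereal) \<Rightarrow> bool" where
  "legendre_type h \<longleftrightarrow> essentially_smooth h \<and>
     strictly_convex_on (interior (edom h)) (finite_part h)"

text \<open>Only meant for \<open>x\<close> in the domain of \<open>h\<close> and \<open>y\<close> in its interior.\<close>

definition bregman_dist :: "(real^'n \<Rightarrow> ereal) \<Rightarrow> real^'n \<Rightarrow> real^'n \<Rightarrow> real" where
  "bregman_dist h x y =
     finite_part h x - finite_part h y - gradient (finite_part h) y \<bullet> (x - y)"

definition bregman_function :: "(real^'n) set \<Rightarrow> (real^'n \<Rightarrow> ereal) \<Rightarrow> bool" where
  "bregman_function C h \<longleftrightarrow> h \<in> Gamma0 \<and>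
     edom h = closure C \<and>
     continuous_on (closure C) (finite_part h) \<and>
     strictly_convex_on (closure C) (finite_part h) \<and>
     C1_on C (finite_part h) \<and>
     (\<forall>a\<in>closure C. \<forall>\<gamma>. bounded {y \<in> C. bregman_dist h a y \<le> \<gamma>}) \<and>
     (\<forall>y\<in>closure C. \<forall>Y. (\<forall>j. Y j \<in> C) \<and> Y \<longlonglongrightarrow> y \<longrightarrow>
        (\<lambda>j. bregman_dist h y (Y j)) \<longlonglongrightarrow> 0)"

definition affine_constraint :: "real^'n^'m \<Rightarrow> real^'m \<Rightarrow> (real^'n) set" where
  "affine_constraint A b = {x. A *v x = b}"

definition optimal_solutions ::
  "(real^'n \<Rightarrow> real) \<Rightarrow> (real^'n) set \<Rightarrow> real^'n^'m \<Rightarrow> real^'m \<Rightarrow> (real^'n) set" where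
  "optimal_solutions f C A b =
     {x \<in> closure C \<inter> affine_constraint A b.
        \<forall>y \<in> closure C \<inter> affine_constraint A b. f x \<le> f y}"

definition H_metric :: "(real^'n \<Rightarrow> real^'n^'n) \<Rightarrow> real^'n \<Rightarrow> real^'n \<Rightarrow> real^'n \<Rightarrow> real" where
  "H_metric H x u v = (H x *v u) \<bullet> v"

definition H_gradient ::
  "(real^'n \<Rightarrow> real^'n^'n) \<Rightarrow> real^'n^'m \<Rightarrow> (real^'n \<Rightarrow> real) \<Rightarrow> real^'n \<Rightarrow> real^'n" where
  "H_gradient H A f x =
     (let Hi = matrix_inv (H x)
      in (Hi ** (mat 1 - transpose A ** matrix_inv (A ** Hi ** transpose A) ** A ** Hi))
           *v gradient f x)"

text \<open>The formula above is the gradient of the restriction of \<open>f\<close> to the affine set for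
  the metric \<^term>\<open>H_metric H\<close>: it is tangent to the affine set and represents the
  differential of \<open>f\<close> on the tangent space.\<close>

lemma sym_pos_def_invertible:
  assumes "sym_pos_def M"
  shows "invertible M"
proof -
  have "v = 0" if "M *v v = 0" for v
    using assms that unfolding sym_pos_def_def by force
  then show ?thesis
    by (simp add: invertible_left_inverse matrix_left_invertible_ker)
qed

lemma matrix_inv_right:
  fixes M :: "real^'n^'n"
  assumes "invertible M"
  shows "M ** matrix_inv M = mat 1"
  using assms someI_ex[of "\<lambda>M'. M ** M' = mat 1 \<and> M' ** M = mat 1"]
  unfolding invertible_def matrix_inv_def by blast

lemma H_gradient_characterization:
  fixes A :: "real^'n^'m" and H :: "real^'n \<Rightarrow> real^'n^'n"
  assumes spd: "sym_pos_def (H x)" and rk: "rank A = CARD('m)"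
  shows "A *v H_gradient H A f x = 0"
    and "A *v u = 0 \<Longrightarrow> H_metric H x (H_gradient H A f x) u = gradient f x \<bullet> u"
proof -
  define Hi where "Hi = matrix_inv (H x)"
  define S where "S = A ** Hi ** transpose A"
  define v where "v = gradient f x"
  define w where "w = matrix_inv S *v (A *v (Hi *v v))"
  have HHi: "H x ** Hi = mat 1"
    using matrix_inv_right[OF sym_pos_def_invertible[OF spd]] by (simp add: Hi_def)
  have "y = 0" if "S *v y = 0" for y
  proof -
    let ?z = "transpose A *v y"
    have "(Hi *v ?z) \<bullet> ?z = (A *v (Hi *v ?z)) \<bullet> y"
      by (metis dot_lmul_matrix inner_commute transpose_matrix_vector)
    also have "\<dots> = 0"
      using that by (simp add: S_def matrix_vector_mul_assoc[symmetric] del: transpose_matrix_vector)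
    finally have *: "(H x *v (Hi *v ?z)) \<bullet> (Hi *v ?z) = 0"
      by (simp add: matrix_vector_mul_assoc HHi inner_commute)
    then have "Hi *v ?z = 0"
      using spd unfolding sym_pos_def_def by force
    then have "?z = 0"
      by (metis HHi matrix_vector_mul_assoc matrix_vector_mul_lid matrix_vector_mult_0_right)
    moreover have "rank (transpose A) = CARD('m)"
      using rk by (simp add: rank_transpose)
    ultimately show "y = 0"
      by (metis full_rank_injective injD matrix_vector_mult_0_right)
  qed
  then have "invertible S"
    by (simp add: invertible_left_inverse matrix_left_invertible_ker)
  then have "S ** matrix_inv S = mat 1"
    by (rule matrix_inv_right)
  then have Sw: "S *v w = A *v (Hi *v v)"
    unfolding w_def by (metis matrix_vector_mul_assoc matrix_vector_mul_lid)
  have g: "H_gradient H A f x = Hi *v (v - transpose A *v w)"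
    unfolding H_gradient_def Let_def Hi_def[symmetric] S_def[symmetric] v_def[symmetric]
    by (simp add: w_def matrix_vector_mult_diff_rdistrib matrix_vector_mul_assoc[symmetric]
        del: transpose_matrix_vector)
  have "A *v (Hi *v (transpose A *v w)) = S *v w"
    by (simp add: S_def matrix_vector_mul_assoc[symmetric] del: transpose_matrix_vector)
  then show "A *v H_gradient H A f x = 0"
    by (simp add: g matrix_vector_mult_diff_distrib Sw del: transpose_matrix_vector)
  assume u: "A *v u = 0"
  have "(transpose A *v w) \<bullet> u = w \<bullet> (A *v u)"
    by (metis dot_lmul_matrix transpose_matrix_vector)
  then show "H_metric H x (H_gradient H A f x) u = gradient f x \<bullet> u"
    unfolding H_metric_def g
    by (simp add: matrix_vector_mul_assoc HHi u inner_diff_left v_def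
        del: transpose_matrix_vector)
qed

text \<open>Global solutions of the Cauchy problem; the derivative at time 0 is one-sided.\<close>

definition HSD_solution ::
  "(real^'n \<Rightarrow> real^'n^'n) \<Rightarrow> (real^'n) set \<Rightarrow> real^'n^'m \<Rightarrow> real^'m \<Rightarrow> (real^'n \<Rightarrow> real)
     \<Rightarrow> real^'n \<Rightarrow> (real \<Rightarrow> real^'n) \<Rightarrow> bool" where
  "HSD_solution H C A b f x0 x \<longleftrightarrow>
     (\<forall>t\<ge>0. x t \<in> C \<inter> affine_constraint A b) \<and>
     (\<forall>t\<ge>0. (x has_vector_derivative (- H_gradient H A f (x t))) (at t within {0..})) \<and>
     x 0 = x0"

end

theory Submission
  imports Defs
begin

text \<open>Along the trajectory \<open>x\<close>, the function \<open>D t = D\<^sub>h(a, x t)\<close> has derivative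
  \<open>\<langle>\<nabla>f(x t), a - x t\<rangle> \<le> f a - f (x t)\<close>, because \<open>a - x t\<close> is tangent to the affine
  constraint. So \<open>D\<close> is nonincreasing, the trajectory is bounded by property (ii) of Bregman
  functions, and, \<open>f (x t)\<close> being nonincreasing as well, \<open>t * (f (x t) - f a) \<le> D 0\<close>. Outside
  \<open>U\<^sub>a\<close>, \<open>f\<close> is bounded away from \<open>f a\<close> on the compact set containing the trajectory, which
  therefore stays in \<open>U\<^sub>a\<close> from some time on. From then on \<open>D' \<le> - \<alpha> * D powr \<beta>\<close>, which is
  integrated explicitly.\<close>

section \<open>Scalar differential inequalities\<close>

text \<open>At the endpoints the derivative serves only to give continuity, so a one-sided one
  suffices. This covers time 0, where the trajectory is only differentiable from the right.\<close>

lemma has_real_derivative_within_nonpos_imp_le: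
  fixes g :: "real \<Rightarrow> real"
  assumes "s \<le> t"
    and der: "\<And>r. s \<le> r \<Longrightarrow> r \<le> t \<Longrightarrow> (g has_real_derivative g' r) (at r within {s..t})"
    and le: "\<And>r. s < r \<Longrightarrow> r < t \<Longrightarrow> g' r \<le> 0"
  shows "g t \<le> g s"
proof (rule DERIV_nonpos_imp_decreasing_open[OF \<open>s \<le> t\<close>])
  show "\<exists>y. DERIV g r :> y \<and> y \<le> 0" if "s < r" "r < t" for r
    using der[of r] le[of r] that by (auto simp: at_within_Icc_at)
  show "continuous_on {s..t} g"
    using DERIV_continuous[OF der] by (simp add: continuous_on_eq_continuous_within)
qed

text \<open>From \<open>T\<close> on, the weighted function \<open>D t * exp (c * t)\<close> has
  nonpositive derivative. Up to time \<open>T\<close>, it is bounded by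
  \<open>D 0 * exp (c * T)\<close> by monotonicity alone.\<close>

lemma exp_decay_of_differential_inequality:
  fixes D D' :: "real \<Rightarrow> real"
  assumes "T \<ge> 0" "c > 0"
    and der: "\<And>t. t \<ge> T \<Longrightarrow> (D has_real_derivative D' t) (at t within {T..})"
    and le: "\<And>t. t \<ge> T \<Longrightarrow> D' t \<le> - c * D t"
    and mono: "\<And>s t. 0 \<le> s \<Longrightarrow> s \<le> t \<Longrightarrow> D t \<le> D s"
    and nonneg: "\<And>t. t \<ge> 0 \<Longrightarrow> D t \<ge> 0"
  shows "\<exists>K>0. \<forall>t>0. D t \<le> K * exp (- c * t)"
proof -
  have weighted: "D t * exp (c * t) \<le> D 0 * exp (c * T)" if "t > 0" for t
  proof (cases "t \<le> T")
    case True
    then show ?thesis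
      using mono[of 0 t] nonneg[of 0] \<open>c > 0\<close> \<open>t > 0\<close> by (intro mult_mono) auto
  next
    case False
    have "D t * exp (c * t) \<le> D T * exp (c * T)"
    proof (rule has_real_derivative_within_nonpos_imp_le[where g = "\<lambda>r. D r * exp (c * r)"])
      show "((\<lambda>r. D r * exp (c * r)) has_real_derivative (D' r + c * D r) * exp (c * r))
              (at r within {T..t})" if "T \<le> r" "r \<le> t" for r
        using has_field_derivative_subset[OF der[OF that(1)], of "{T..t}"]
        by (auto intro!: derivative_eq_intros simp: algebra_simps)
      show "(D' r + c * D r) * exp (c * r) \<le> 0" if "T < r" for r
        using le[of r] that by (simp add: mult_le_0_iff)
    qed (use False in auto)
    also have "\<dots> \<le> D 0 * exp (c * T)"
      using mono[of 0 T] \<open>T \<ge> 0\<close> by simp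
    finally show ?thesis .
  qed
  \<comment> \<open>The summand 1 keeps the constant positive when \<open>D 0 = 0\<close>.\<close>
  have "D t \<le> (D 0 * exp (c * T) + 1) * exp (- c * t)" if "t > 0" for t
    using weighted[OF that] by (simp add: exp_minus field_simps add_increasing2)
  moreover have "D 0 * exp (c * T) + 1 > 0"
    using nonneg[of 0] by (simp add: add_nonneg_pos)
  ultimately show ?thesis by blast
qed

text \<open>While \<open>D\<close> is positive, \<open>D t powr (- (\<beta> - 1))\<close> has
  derivative at least \<open>(\<beta> - 1) * c\<close>, hence grows at least linearly from
  \<open>T\<close> on; inverting the power gives the rate. Early times are again handled by
  monotonicity.\<close>

lemma powr_decay_of_differential_inequality:
  fixes D D' :: "real \<Rightarrow> real"
  assumes "T \<ge> 0" "c > 0" "\<beta> > 1"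
    and der: "\<And>t. t \<ge> T \<Longrightarrow> (D has_real_derivative D' t) (at t within {T..})"
    and le: "\<And>t. t \<ge> T \<Longrightarrow> D' t \<le> - c * D t powr \<beta>"
    and mono: "\<And>s t. 0 \<le> s \<Longrightarrow> s \<le> t \<Longrightarrow> D t \<le> D s"
    and nonneg: "\<And>t. t \<ge> 0 \<Longrightarrow> D t \<ge> 0"
  shows "\<exists>K>0. \<forall>t>0. D t \<le> K / t powr (1 / (\<beta> - 1))"
proof -
  define p where "p = \<beta> - 1"
  define k where "k = p * c"
  have "p > 0" "k > 0"
    using assms by (auto simp: p_def k_def)
  \<comment> \<open>Positivity is only asked at the final time: since \<open>D\<close> is
    nonincreasing, it propagates back to all of \<open>{T..t}\<close>, where the negative power is
    then differentiable.\<close>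
  have integrated: "k * (t - T) \<le> D t powr (- p)" if "t \<ge> T" "D t > 0" for t
  proof -
    have pos: "D r > 0" if "T \<le> r" "r \<le> t" for r
      using mono[of r t] that \<open>D t > 0\<close> \<open>T \<ge> 0\<close> by auto
    have "k * t - D t powr (- p) \<le> k * T - D T powr (- p)"
    proof (rule has_real_derivative_within_nonpos_imp_le[where g = "\<lambda>r. k * r - D r powr (- p)"])
      show "((\<lambda>r. k * r - D r powr (- p)) has_real_derivative
              k - (- p * D r powr (- p - 1)) * D' r) (at r within {T..t})"
        if "T \<le> r" "r \<le> t" for r
      proof -
        have "((\<lambda>r. D r powr (- p)) has_real_derivative (- p * D r powr (- p - 1)) * D' r)
                (at r within {T..t})"
          by (rule DERIV_chain2[OF has_real_derivative_powr[OF pos[OF that]]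
                has_field_derivative_subset[OF der[OF that(1)]]]) auto
        from DERIV_diff[OF DERIV_cmult[OF DERIV_ident] this] show ?thesis
          by simp
      qed
      show "k - (- p * D r powr (- p - 1)) * D' r \<le> 0" if "T < r" "r < t" for r
      proof -
        have "D r powr (- p - 1) * D r powr \<beta> = 1"
          using pos[of r] that by (simp add: powr_add[symmetric] p_def)
        moreover have "(p * D r powr (- p - 1)) * D' r
            \<le> (p * D r powr (- p - 1)) * (- c * D r powr \<beta>)"
          using le[of r] that \<open>p > 0\<close> by (intro mult_left_mono) auto
        ultimately show ?thesis
          by (simp add: k_def algebra_simps)
      qed
    qed (use that in auto)
    \<comment> \<open>The nonnegative term \<open>D T powr (- p)\<close> is dropped.\<close>
    then show ?thesis
      by (simp add: algebra_simps) (smt (verit) powr_ge_zero)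
  qed
  \<comment> \<open>The first summand serves for \<open>t > 2 * T\<close>, where
    \<open>t - T \<ge> t / 2\<close>; the second serves for \<open>t \<le> 2 * T\<close>, where
    \<open>D t \<le> D 0\<close>.\<close>
  define K where "K = (2 / k) powr (1 / p) + D 0 * (2 * T) powr (1 / p)"
  have K1: "(2 / k) powr (1 / p) \<le> K" and K2: "D 0 * (2 * T) powr (1 / p) \<le> K"
    and "K > 0"
    using nonneg[of 0] \<open>k > 0\<close> by (auto simp: K_def add_pos_nonneg)
  have "D t \<le> K / t powr (1 / p)" if "t > 0" for t
  proof (cases "D t > 0")
    case False
    moreover have "0 \<le> K / t powr (1 / p)"
      using \<open>K > 0\<close> by simp
    ultimately show ?thesis by linarith
  next
    case Dpos: True
    show ?thesis
    proof (cases "t \<le> 2 * T")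
      case True
      have "D t * t powr (1 / p) \<le> D 0 * (2 * T) powr (1 / p)"
        using True \<open>t > 0\<close> \<open>p > 0\<close> mono[of 0 t] nonneg[of 0]
        by (intro mult_mono powr_mono2) auto
      then show ?thesis
        using K2 \<open>t > 0\<close> by (simp add: pos_le_divide_eq)
    next
      case False
      have "k * (t / 2) \<le> k * (t - T)"
        using False \<open>k > 0\<close> by simp
      also have "\<dots> \<le> D t powr (- p)"
        using False \<open>T \<ge> 0\<close> \<open>t > 0\<close> by (intro integrated Dpos) auto
      \<comment> \<open>Raising to the negative power \<open>- (1 / p)\<close> reverses the
        inequality and recovers \<open>D t\<close>.\<close>
      finally have "(D t powr (- p)) powr (- (1 / p)) \<le> (k * (t / 2)) powr (- (1 / p))"
        using \<open>k > 0\<close> \<open>t > 0\<close> \<open>p > 0\<close> by (intro powr_mono2') auto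
      moreover have "(D t powr (- p)) powr (- (1 / p)) = D t"
        using Dpos \<open>p > 0\<close> by (simp add: powr_powr)
      moreover have "(k * (t / 2)) powr (- (1 / p)) = (2 / k) powr (1 / p) / t powr (1 / p)"
        using \<open>k > 0\<close> \<open>t > 0\<close> by (simp add: powr_minus powr_divide powr_mult field_simps)
      ultimately show ?thesis
        using K1 by (smt (verit) divide_right_mono powr_ge_zero)
    qed
  qed
  then show ?thesis
    using \<open>K > 0\<close> by (auto simp: p_def)
qed

section \<open>Gradients, convexity and the Bregman distance\<close>

text \<open>The gradient is a definite description, so a representing vector must be shown to exist
  and to be unique. Existence is Riesz representation, with coordinates \<open>L i\<close>;
  uniqueness comes from that of the derivative.\<close>

lemma has_derivative_gradient:
  fixes g :: "'a::euclidean_space \<Rightarrow> real"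
  assumes "g differentiable (at y)"
  shows "(g has_derivative (\<lambda>v. gradient g y \<bullet> v)) (at y)"
proof -
  obtain L where L: "(g has_derivative L) (at y)"
    using assms by (auto simp: differentiable_def)
  define G where "G = (\<Sum>i\<in>Basis. L i *\<^sub>R i)"
  interpret L: bounded_linear L
    using L by (rule has_derivative_bounded_linear)
  have "L v = v \<bullet> G" for v
  proof -
    have "L v = L (\<Sum>i\<in>Basis. (v \<bullet> i) *\<^sub>R i)"
      by (simp only: euclidean_representation)
    also have "\<dots> = (\<Sum>i\<in>Basis. (v \<bullet> i) * L i)"
      by (simp only: L.sum L.scaleR real_scaleR_def)
    also have "\<dots> = v \<bullet> G"
      by (simp add: G_def inner_sum_right mult.commute)
    finally show ?thesis .
  qed
  then have "L = (\<lambda>v. v \<bullet> G)"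
    by (rule ext)
  then have G: "GDERIV g y :> G"
    using L by (simp only: gderiv_def)
  have "gradient g y = G"
    unfolding gradient_def
  proof (rule the_equality)
    show "GDERIV g y :> G" by (fact G)
    fix G' assume "GDERIV g y :> G'"
    then have "(\<lambda>v. v \<bullet> G') = (\<lambda>v. v \<bullet> G)"
      using G unfolding gderiv_def by (rule has_derivative_unique)
    then have "\<forall>v. v \<bullet> G' = v \<bullet> G"
      by (simp add: fun_eq_iff)
    then show "G' = G"
      by (rule vector_eq_ldot[THEN iffD1])
  qed
  then show ?thesis
    using G by (simp add: gderiv_def inner_commute)
qed

lemma has_derivative_gradient_hessian:
  assumes "gradient g differentiable (at y)"
  shows "(gradient g has_derivative (\<lambda>v. hessian g y *v v)) (at y)"
  using assms by (simp add: hessian_def jacobian_works)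

text \<open>Convexity bounds the difference quotients along the segment from \<open>y\<close> to
  \<open>z\<close> by \<open>g z - g y\<close>; let the step tend to 0 from the right. Nothing is
  differentiated at \<open>z\<close>, which may thus be a boundary point such as
  \<open>a\<close>.\<close>

lemma convex_on_above_gradient:
  fixes g :: "'a::euclidean_space \<Rightarrow> real"
  assumes cvx: "convex_on S g" and diff: "g differentiable (at y)" and "y \<in> S" "z \<in> S"
  shows "g y + gradient g y \<bullet> (z - y) \<le> g z"
proof -
  define q where "q s = g (y + s *\<^sub>R (z - y))" for s :: real
  have "(q has_derivative (\<lambda>s. gradient g y \<bullet> (s *\<^sub>R (z - y)))) (at 0)"
    unfolding q_def
    by (rule has_derivative_compose[where g = g and g' = "\<lambda>v. gradient g y \<bullet> v"])
       (auto intro!: derivative_eq_intros has_derivative_gradient diff)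
  then have "(q has_real_derivative gradient g y \<bullet> (z - y)) (at 0)"
    by (simp add: has_field_derivative_def mult_commute_abs)
  then have "((\<lambda>s. (q s - q 0) / s) \<longlongrightarrow> gradient g y \<bullet> (z - y)) (at_right 0)"
    by (auto simp: has_field_derivative_iff intro: tendsto_mono[OF at_le])
  moreover have "\<forall>\<^sub>F s in at_right 0. (q s - q 0) / s \<le> g z - g y"
  proof -
    have "(q s - q 0) / s \<le> g z - g y" if "0 < s" "s < 1" for s
    proof -
      have "y + s *\<^sub>R (z - y) = (1 - s) *\<^sub>R y + s *\<^sub>R z"
        by (simp add: algebra_simps)
      then have "q s \<le> (1 - s) * g y + s * g z"
        using convex_onD[OF cvx, of s y z] that assms by (simp add: q_def)
      then show ?thesis
        using that by (simp add: q_def field_simps)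
    qed
    then show ?thesis
      by (auto simp: eventually_at_right_field intro!: exI[of _ 1])
  qed
  ultimately have "gradient g y \<bullet> (z - y) \<le> g z - g y"
    by (rule tendsto_upperbound) simp
  then show ?thesis by simp
qed

lemma strictly_convex_on_imp_convex_on:
  assumes "strictly_convex_on S g"
  shows "convex_on S g"
  unfolding convex_on_def
proof (intro conjI ballI allI impI)
  show "convex S"
    using assms by (simp add: strictly_convex_on_def)
  fix x y and u v :: real
  assume *: "x \<in> S" "y \<in> S" "0 \<le> u" "0 \<le> v" "u + v = 1"
  show "g (u *\<^sub>R x + v *\<^sub>R y) \<le> u * g x + v * g y"
  proof (cases "x = y \<or> u = 0 \<or> v = 0")
    case True
    then show ?thesis
      using * by (auto simp: scaleR_left_distrib[symmetric] distrib_right[symmetric])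
  next
    case False
    then show ?thesis
      using * assms unfolding strictly_convex_on_def by (intro less_imp_le) auto
  qed
qed

lemma bregman_dist_nonneg:
  assumes "convex_on S (finite_part h)" "finite_part h differentiable (at y)" "z \<in> S" "y \<in> S"
  shows "bregman_dist h z y \<ge> 0"
  using convex_on_above_gradient[OF assms(1,2,4,3)] by (simp add: bregman_dist_def)

text \<open>Differentiating in the second argument, the two terms that pair the gradient with
  \<open>x'\<close> cancel, and only the Hessian term survives. The value at \<open>a\<close> enters
  as a constant.\<close>

lemma bregman_dist_has_real_derivative:
  assumes x: "(x has_vector_derivative x') (at t within S)"
    and h1: "finite_part h differentiable (at (x t))"
    and h2: "gradient (finite_part h) differentiable (at (x t))"
  shows "((\<lambda>s. bregman_dist h a (x s)) has_real_derivative
           - ((hessian (finite_part h) (x t) *v x') \<bullet> (a - x t))) (at t within S)"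
proof -
  define g where "g = finite_part h"
  have x': "(x has_derivative (\<lambda>s. s *\<^sub>R x')) (at t within S)"
    using x by (simp add: has_vector_derivative_def)
  have d0: "((\<lambda>s. g (x s)) has_derivative (\<lambda>s. gradient g (x t) \<bullet> (s *\<^sub>R x'))) (at t within S)"
    using has_derivative_compose[OF x' has_derivative_gradient[OF h1]] by (simp add: g_def)
  have d1: "((\<lambda>s. gradient g (x s)) has_derivative (\<lambda>s. hessian g (x t) *v (s *\<^sub>R x')))
      (at t within S)"
    using has_derivative_compose[OF x' has_derivative_gradient_hessian[OF h2]] by (simp add: g_def)
  show ?thesis
    unfolding bregman_dist_def g_def[symmetric] has_field_derivative_def
    by (rule derivative_eq_intros d0 d1 x' refl)+
       (auto simp: fun_eq_iff matrix_vector_mult_scaleR algebra_simps inner_diff_right)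
qed

section \<open>Points near the unique minimizer\<close>

lemma optimal_solution_unique_strict:
  assumes "optimal_solutions f C A b = {a}"
    and "y \<in> closure C" "y \<in> affine_constraint A b" "y \<noteq> a"
  shows "f a < f y"
proof (rule ccontr)
  assume "\<not> f a < f y"
  moreover have "\<forall>z \<in> closure C \<inter> affine_constraint A b. f a \<le> f z"
    using assms(1) by (auto simp: optimal_solutions_def set_eq_iff)
  ultimately have "y \<in> optimal_solutions f C A b"
    using assms by (force simp: optimal_solutions_def)
  then show False
    using assms by simp
qed

lemma closed_affine_constraint: "closed (affine_constraint A b)"
  unfolding affine_constraint_def
  by (intro closed_Collect_eq continuous_intros linear_continuous_on matrix_vector_mul_bounded_linear)

text \<open>By compactness, \<open>f\<close> attains its minimum over the feasible points of
  \<open>closure B\<close> outside \<open>interior U\<close>. By uniqueness of the minimizer this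
  value exceeds \<open>f a\<close>, and the difference serves as \<epsilon>.\<close>

lemma near_optimal_values_near_optimal_solution:
  fixes C :: "(real^'n) set"
  assumes sol: "optimal_solutions f C A b = {a}" and cont: "continuous_on UNIV f"
    and "a \<in> interior U" and "bounded B" and "B \<subseteq> C"
  obtains \<epsilon> where "\<epsilon> > 0"
    "\<And>y. y \<in> B \<Longrightarrow> y \<in> affine_constraint A b \<Longrightarrow> f y < f a + \<epsilon> \<Longrightarrow> y \<in> U"
proof -
  define K where "K = closure B \<inter> affine_constraint A b - interior U"
  have "compact K"
    unfolding K_def using \<open>bounded B\<close>
    by (intro compact_diff compact_Int_closed closed_affine_constraint open_interior) auto
  have inK: "y \<in> K" if "y \<in> B" "y \<in> affine_constraint A b" "y \<notin> U" for y
    using that closure_subset interior_subset by (auto simp: K_def)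
  show thesis
  \<comment> \<open>If \<open>K\<close> is empty there is no minimum to take, but every point
    concerned lies in \<open>U\<close> and any positive \<epsilon> will do.\<close>
  proof (cases "K = {}")
    case True
    then show thesis
      using inK that[of 1] by auto
  next
    case False
    then obtain p where p: "p \<in> K" "\<And>y. y \<in> K \<Longrightarrow> f p \<le> f y"
      using continuous_attains_inf[OF \<open>compact K\<close> False] cont
      by (meson continuous_on_subset subset_UNIV)
    have "f a < f p"
      using p(1) \<open>a \<in> interior U\<close> closure_mono[OF \<open>B \<subseteq> C\<close>]
      by (intro optimal_solution_unique_strict[OF sol]) (auto simp: K_def)
    then show thesis
      using p(2) inK by (intro that[of "f p - f a"]) force+
  qed
qed

section \<open>Decay of the Bregman distance along the trajectory\<close>

theorem proposition4p2:
  fixes A :: "real^'n^'m" and b :: "real^'m"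
    and C :: "(real^'n) set" and f :: "real^'n \<Rightarrow> real" and h :: "real^'n \<Rightarrow> ereal"
    and a x0 :: "real^'n" and x :: "real \<Rightarrow> real^'n"
    and Ua :: "(real^'n) set" and \<alpha> \<beta> :: real
  assumes "CARD('m) < CARD('n)" and "rank A = CARD('m)" and "b \<in> range ((*v) A)"
    and "C \<noteq> {}" and "open C" and "convex C"
    and "C \<inter> affine_constraint A b \<noteq> {}"
    and "C1_on UNIV f" and "locally_lipschitz_on UNIV (gradient f)"
    and "h \<in> Gamma0"
    and "legendre_type h" and "interior (edom h) = C"
    and "C2_on C (finite_part h)"
    and "\<And>y. y \<in> C \<Longrightarrow> sym_pos_def (hessian (finite_part h) y)"
    and "locally_lipschitz_on C (hessian (finite_part h))"
    and "convex_on UNIV f"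
    and "optimal_solutions f C A b = {a}"
    and "bregman_function C h"
    and "a \<in> interior Ua" and "\<alpha> > 0" and "\<beta> \<ge> 1"
    and "\<And>y. y \<in> Ua \<inter> C \<Longrightarrow> f y - f a \<ge> \<alpha> * bregman_dist h a y powr \<beta>"
    and "x0 \<in> C \<inter> affine_constraint A b"
    and "HSD_solution (hessian (finite_part h)) C A b f x0 x"
  shows "(\<beta> = 1 \<longrightarrow> (\<exists>K>0. \<forall>t>0. bregman_dist h a (x t) \<le> K * exp (- \<alpha> * t))) \<and>
         (\<beta> > 1 \<longrightarrow> (\<exists>K'>0. \<forall>t>0. bregman_dist h a (x t) \<le> K' / t powr (1 / (\<beta> - 1))))"
proof -
  define g where "g = finite_part h"
  define H where "H = hessian g"
  define v where "v t = H_gradient H A f (x t)" for t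
  define D where "D t = bregman_dist h a (x t)" for t
  have f_diff: "f differentiable (at y)" for y
    using \<open>C1_on UNIV f\<close> by (simp add: C1_on_def)
  have f_cont: "continuous_on UNIV f"
    using f_diff by (simp add: continuous_on_eq_continuous_within differentiable_imp_continuous_within)
  have g_diff: "g differentiable (at y)" "gradient g differentiable (at y)" if "y \<in> C" for y
    using \<open>C2_on C (finite_part h)\<close> that by (auto simp: C2_on_def C1_on_def g_def)
  have g_convex: "convex_on (closure C) g"
    using \<open>bregman_function C h\<close> strictly_convex_on_imp_convex_on
    by (auto simp: bregman_function_def g_def)
  have spd: "sym_pos_def (H y)" if "y \<in> C" for y
    using assms(14)[OF that] by (simp add: H_def g_def)
  have a: "a \<in> closure C" "a \<in> affine_constraint A b"
    and a_min: "\<And>y. y \<in> closure C \<Longrightarrow> y \<in> affine_constraint A b \<Longrightarrow> f a \<le> f y"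
    using assms(17) by (auto simp: optimal_solutions_def set_eq_iff)
  have xC: "x t \<in> C" and xA: "x t \<in> affine_constraint A b"
    and x_der: "(x has_vector_derivative - v t) (at t within {0..})" if "t \<ge> 0" for t
    using assms(24) that by (auto simp: HSD_solution_def v_def H_def g_def)
  have xclC: "x t \<in> closure C" if "t \<ge> 0" for t
    using xC[OF that] closure_subset by blast

  \<comment> \<open>Convexity is used on the closure of \<open>C\<close> because \<open>a\<close>
    may lie on its boundary.\<close>
  have D_nonneg: "D t \<ge> 0" if "t \<ge> 0" for t
    unfolding D_def using g_convex g_diff(1)[OF xC[OF that]] a(1) xclC[OF that]
    by (intro bregman_dist_nonneg) (auto simp: g_def)

  \<comment> \<open>This represents the differential of \<open>f\<close> on tangent vectors. It is
    applied to \<open>a - x t\<close> for the derivative of \<open>D\<close>, and to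
    \<open>v t\<close> itself for that of \<open>f\<close> along the trajectory.\<close>
  have Hv: "(H (x t) *v v t) \<bullet> u = gradient f (x t) \<bullet> u" if "t \<ge> 0" "A *v u = 0" for t u
    using H_gradient_characterization(2)[where H = H, OF spd[OF xC[OF that(1)]] assms(2) that(2)]
    by (simp add: H_metric_def v_def)
  have Av: "A *v v t = 0" if "t \<ge> 0" for t
    using H_gradient_characterization(1)[where H = H, OF spd[OF xC[OF that]] assms(2)]
    by (simp add: v_def)

  \<comment> \<open>The Hessian in the derivative of the Bregman distance is the metric that defines
    the flow, so the two cancel and \<open>D'\<close> no longer involves \<open>H\<close>.\<close>
  define D' where "D' t = gradient f (x t) \<bullet> (a - x t)" for t
  have D_der: "(D has_real_derivative D' t) (at t within {0..})" if "t \<ge> 0" for t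
  proof -
    have "A *v (a - x t) = 0"
      using a(2) xA[OF that] by (simp add: affine_constraint_def matrix_vector_mult_diff_distrib)
    then have "- ((H (x t) *v (- v t)) \<bullet> (a - x t)) = D' t"
      using Hv[OF that] by (simp add: D'_def linear_neg)
    then show ?thesis
      using bregman_dist_has_real_derivative[OF x_der[OF that], of h a] g_diff[OF xC[OF that]]
      unfolding D_def H_def g_def by simp
  qed
  have D'_le: "D' t \<le> f a - f (x t)" for t
    using convex_on_above_gradient[OF \<open>convex_on UNIV f\<close> f_diff, of "x t" a]
    by (simp add: D'_def)
  have D_mono: "D t \<le> D s" if "0 \<le> s" "s \<le> t" for s t
  proof (rule has_real_derivative_within_nonpos_imp_le[where g = D, OF \<open>s \<le> t\<close>])
    show "(D has_real_derivative D' r) (at r within {s..t})" if "s \<le> r" for r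
      using has_field_derivative_subset[OF D_der[of r], of "{s..t}"] that \<open>0 \<le> s\<close> by auto
    show "D' r \<le> 0" if "s < r" for r
      using D'_le[of r] a_min[of "x r"] xclC[of r] xA[of r] that \<open>0 \<le> s\<close> by simp
  qed

  have f_mono: "f (x t) \<le> f (x s)" if "0 \<le> s" "s \<le> t" for s t
  proof (rule has_real_derivative_within_nonpos_imp_le[where g = "\<lambda>r. f (x r)", OF \<open>s \<le> t\<close>])
    show "((\<lambda>r. f (x r)) has_real_derivative - (gradient f (x r) \<bullet> v r)) (at r within {s..t})"
      if "s \<le> r" for r
    proof -
      have "(x has_derivative (\<lambda>s. s *\<^sub>R (- v r))) (at r within {s..t})"
        using x_der[of r] that \<open>0 \<le> s\<close> unfolding has_vector_derivative_def
        by (auto intro: has_derivative_subset)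
      from has_derivative_compose[OF this has_derivative_gradient[OF f_diff]] show ?thesis
        unfolding has_field_derivative_def
        by (rule has_derivative_eq_rhs) (auto simp: fun_eq_iff)
    qed
    \<comment> \<open>As \<open>v r\<close> is tangent, this derivative is minus its squared length
      in the metric \<open>H (x r)\<close>.\<close>
    show "- (gradient f (x r) \<bullet> v r) \<le> 0" if "s < r" for r
    proof -
      have "gradient f (x r) \<bullet> v r = (H (x r) *v v r) \<bullet> v r"
        using Hv[of r "v r"] Av[of r] that \<open>0 \<le> s\<close> by simp
      also have "\<dots> \<ge> 0"
        using spd[of "x r"] xC[of r] that \<open>0 \<le> s\<close>
        by (cases "v r = 0") (auto simp: sym_pos_def_def less_imp_le)
      finally show ?thesis by simp
    qed
  qed

  have gap: "t * (f (x t) - f a) \<le> D 0" if "t \<ge> 0" for t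
  proof -
    \<comment> \<open>The gap is frozen at the final time \<open>t\<close>. It is at most the gap at
      any earlier time \<open>s\<close>, hence at most \<open>- D' s\<close>.\<close>
    have "D t + t * (f (x t) - f a) \<le> D 0 + 0 * (f (x t) - f a)"
    proof (rule has_real_derivative_within_nonpos_imp_le[
          where g = "\<lambda>s. D s + s * (f (x t) - f a)", OF \<open>t \<ge> 0\<close>])
      show "((\<lambda>s. D s + s * (f (x t) - f a)) has_real_derivative D' s + (f (x t) - f a))
          (at s within {0..t})" if "0 \<le> s" for s
        using has_field_derivative_subset[OF D_der[OF that], of "{0..t}"]
        by (auto intro!: derivative_eq_intros)
      show "D' s + (f (x t) - f a) \<le> 0" if "0 < s" "s < t" for s
        using D'_le[of s] f_mono[of s t] that by simp
    qed
    then show ?thesis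
      using D_nonneg[OF that] by simp
  qed

  obtain T where "T \<ge> 0" and xU: "\<And>t. t \<ge> T \<Longrightarrow> x t \<in> Ua"
  proof -
    \<comment> \<open>Since \<open>D\<close> is nonincreasing, this Bregman sublevel set contains
      the whole trajectory.\<close>
    define B where "B = {y \<in> C. bregman_dist h a y \<le> D 0}"
    have "bounded B" "B \<subseteq> C"
      using \<open>bregman_function C h\<close> a(1) by (auto simp: bregman_function_def B_def)
    then obtain \<epsilon> where "\<epsilon> > 0"
      and \<epsilon>: "\<And>y. y \<in> B \<Longrightarrow> y \<in> affine_constraint A b \<Longrightarrow> f y < f a + \<epsilon> \<Longrightarrow> y \<in> Ua"
      using near_optimal_values_near_optimal_solution[OF assms(17) f_cont \<open>a \<in> interior Ua\<close>]
      by metis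
    \<comment> \<open>By \<open>gap\<close>, the value gap is at most \<open>D 0 / t\<close>, which
      is below \<epsilon> once \<open>t > D 0 / \<epsilon>\<close>. Adding 1 makes this strict for
      all \<open>t \<ge> T\<close> and keeps \<open>T\<close> positive.\<close>
    define T where "T = D 0 / \<epsilon> + 1"
    have "T > 0"
      using D_nonneg[of 0] \<open>\<epsilon> > 0\<close> by (simp add: T_def add_nonneg_pos)
    moreover have "x t \<in> Ua" if "t \<ge> T" for t
    proof (rule \<epsilon>)
      have "t > 0"
        using that \<open>T > 0\<close> by simp
      then show "x t \<in> B" "x t \<in> affine_constraint A b"
        using xC[of t] xA[of t] D_mono[of 0 t] by (auto simp: B_def D_def)
      have "D 0 / \<epsilon> < t"
        using that by (simp add: T_def)
      then have "D 0 < t * \<epsilon>"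
        using \<open>\<epsilon> > 0\<close> by (simp add: pos_divide_less_eq)
      then have "t * (f (x t) - f a) < t * \<epsilon>"
        using gap[of t] \<open>t > 0\<close> by linarith
      then have "f (x t) - f a < \<epsilon>"
        using \<open>t > 0\<close> by (rule mult_left_less_imp_less[OF _ less_imp_le])
      then show "f (x t) < f a + \<epsilon>"
        by simp
    qed
    ultimately show thesis
      using that[of T] by simp
  qed

  have D_der_T: "(D has_real_derivative D' t) (at t within {T..})" if "t \<ge> T" for t
    using has_field_derivative_subset[OF D_der[of t], of "{T..}"] that \<open>T \<ge> 0\<close> by auto
  \<comment> \<open>The growth condition on \<open>Ua\<close> turns the bound by the value gap into
    an inequality in \<open>D\<close> alone.\<close>
  have D'_powr: "D' t \<le> - \<alpha> * D t powr \<beta>" if "t \<ge> T" for t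
    using assms(22)[of "x t"] D'_le[of t] xU[OF that] xC[of t] that \<open>T \<ge> 0\<close> by (simp add: D_def)

  show ?thesis
  proof (intro conjI impI)
    assume "\<beta> = 1"
    \<comment> \<open>Nonnegativity of \<open>D t\<close> is what allows \<open>D t powr 1\<close>
      to be replaced by \<open>D t\<close>.\<close>
    then have "D' t \<le> - \<alpha> * D t" if "t \<ge> T" for t
      using D'_powr[OF that] D_nonneg[of t] that \<open>T \<ge> 0\<close> by simp
    from exp_decay_of_differential_inequality[OF \<open>T \<ge> 0\<close> \<open>\<alpha> > 0\<close> D_der_T this D_mono D_nonneg]
    show "\<exists>K>0. \<forall>t>0. bregman_dist h a (x t) \<le> K * exp (- \<alpha> * t)"
      by (simp add: D_def)
  next
    assume "\<beta> > 1"
    from powr_decay_of_differential_inequality[OF \<open>T \<ge> 0\<close> \<open>\<alpha> > 0\<close> this D_der_T D'_powr D_mono D_nonneg]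
    show "\<exists>K'>0. \<forall>t>0. bregman_dist h a (x t) \<le> K' / t powr (1 / (\<beta> - 1))"
      by (simp add: D_def)
  qed
qed

end
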